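(* Let $\rho>0$, $\beta>0$, $x_0>0$, and let $x_{i+1}=a_ix_i+b_i$ be the linear stochastic recursion described in the context, where the $b_i$ are i.i.d. non-negative random variables with finite mean. Then $$\frac{\log x_n-n\log(1+\rho)}{\sqrt n}\longrightarrow N\left(0,\frac{2\beta}{3}\frac{\rho^2}{(1+\rho)^2}\right)$$ in distribution as $n\to\infty$ (with $\beta=\frac12\sigma^2\tau n^2$ held fixed).
   Context: Setup: for each $n\ge1$ the parameters $\sigma=\sigma_n>0$ and $\tau=\tau_n>0$ satisfy $\frac12\sigma_n^2\tau_n n^2=\beta$, with $\beta$ fixed. $W(t)$ is a standard Brownian motion started at $0$ at time $0$, $t_i=i\tau$, $W_i=W(t_i)$, and $a_i=1+\rho e^{\sigma W_i-\frac12\sigma^2t_i}$. The sequence $(b_i)_{i\ge0}$ is independent of $(a_i)_{i\ge0}$. The process is $x_{i+1}=a_ix_i+b_i$ with deterministic initial value $x_0>0$, and $x_n$ is computed with parameters $\sigma_n,\tau_n$. $N(m,v)$ is the normal law with mean $m$ and variance $v$. *)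

theory Defs
  imports "HOL-Probability.Probability"
begin

text \<open>Second parameter is the variance, as in \<open>N(m, v)\<close>; \<open>normal_density\<close> takes the standard
  deviation instead. This is the normal law only for \<open>v > 0\<close>.\<close>

definition normal_law :: "real \<Rightarrow> real \<Rightarrow> real measure" where
  "normal_law m v = density lborel (\<lambda>x. ennreal (normal_density m (sqrt v) x))"

text \<open>Only the values \<open>W t\<close> with \<open>t \<ge> 0\<close> are constrained.\<close>

locale standard_brownian_motion = prob_space M for M :: "'a measure" +
  fixes W :: "real \<Rightarrow> 'a \<Rightarrow> real"
  assumes W_measurable: "\<And>t. 0 \<le> t \<Longrightarrow> W t \<in> borel_measurable M"
    and W_start: "AE \<omega> in M. W 0 \<omega> = 0"
    and W_indep_increments:
      "\<And>(k::nat) t. 0 \<le> t 0 \<Longrightarrow> (\<And>i. i < k \<Longrightarrow> t i < t (Suc i)) \<Longrightarrow>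
        indep_vars (\<lambda>_. borel) (\<lambda>i \<omega>. W (t (Suc i)) \<omega> - W (t i) \<omega>) {..<k}"
    and W_normal_increments:
      "\<And>s t. 0 \<le> s \<Longrightarrow> s < t \<Longrightarrow>
        distr M borel (\<lambda>\<omega>. W t \<omega> - W s \<omega>) = normal_law 0 (t - s)"
    and W_continuous: "AE \<omega> in M. continuous_on {0..} (\<lambda>t. W t \<omega>)"

definition multiplier ::
  "real \<Rightarrow> real \<Rightarrow> real \<Rightarrow> (real \<Rightarrow> 'a \<Rightarrow> real) \<Rightarrow> nat \<Rightarrow> 'a \<Rightarrow> real" where
  "multiplier \<rho> \<sigma> \<tau> W i \<omega> =
     1 + \<rho> * exp (\<sigma> * W (real i * \<tau>) \<omega> - 1 / 2 * \<sigma>\<^sup>2 * (real i * \<tau>))"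

primrec linear_recursion ::
  "(nat \<Rightarrow> 'a \<Rightarrow> real) \<Rightarrow> (nat \<Rightarrow> 'a \<Rightarrow> real) \<Rightarrow> real \<Rightarrow> nat \<Rightarrow> 'a \<Rightarrow> real" where
  "linear_recursion a b x0 0 \<omega> = x0"
| "linear_recursion a b x0 (Suc i) \<omega> = a i \<omega> * linear_recursion a b x0 i \<omega> + b i \<omega>"

end

theory Submission
  imports Defs "HOL-Real_Asymp.Real_Asymp"
begin

text \<open>
  Unrolling the recursion gives
  \<open>x\<^sub>n = (\<Prod>i<n. a\<^sub>i) * (x\<^sub>0 + (\<Sum>j<n. b\<^sub>j / (\<Prod>i\<le>j. a\<^sub>i)))\<close>.  All multipliers are at least
  \<open>1\<close>, so the second factor lies between \<open>x\<^sub>0\<close> and \<open>x\<^sub>0 + (\<Sum>j<n. b\<^sub>j)\<close>; the latter sum has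
  expectation of order \<open>n\<close>, so the logarithm of that factor is at most of order \<open>ln n\<close> in
  \<open>L\<^sup>1\<close>, which the scaling by \<open>sqrt n\<close> removes.  What remains is
  \<open>\<Sum>i<n. ln (1 + \<rho> * exp y\<^sub>i)\<close> with exponents \<open>y\<^sub>i = \<sigma> W\<^sub>i - \<beta> i / n\<^sup>2\<close>.  Their second moments
  are at most of order \<open>1 / n\<close>, hence replacing the function \<open>y \<mapsto> ln (1 + \<rho> * exp y)\<close> by its
  tangent \<open>ln (1 + \<rho>) + c * y\<close> at \<open>0\<close>, where \<open>c = \<rho> / (1 + \<rho>)\<close>, costs a total \<open>L\<^sup>1\<close> error that
  stays bounded, and so does the sum of the drifts \<open>\<beta> i / n\<^sup>2\<close>.
  The deterministic part of this is lemma \<open>ln_linear_recursion_deviation\<close>.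

  The main term is therefore \<open>c * \<sigma> / sqrt n * (\<Sum>i<n. W\<^sub>i)\<close>.  Summation by parts turns it into a
  weighted sum of independent increments, so it is centred Gaussian for every \<open>n\<close>
  (lemma \<open>char_grid_sum\<close>), with variance
  \<open>c\<^sup>2 * \<sigma>\<^sup>2 * \<tau> / n * (\<Sum>k<n. k\<^sup>2) = 2 * \<beta> * c\<^sup>2 / n\<^sup>3 * (\<Sum>k<n. k\<^sup>2)\<close>, which tends to
  \<open>2 * \<beta> * c\<^sup>2 / 3\<close>.

  The two parts are combined through characteristic functions: a perturbation that is small in
  \<open>L\<^sup>1\<close> changes them little, and Levy's continuity theorem concludes
  (lemma \<open>weak_conv_L1_perturbation\<close>).
\<close>

section \<open>The logarithm of a linear recursion\<close>

text \<open>
  Taylor's formula at \<open>0\<close>: the second derivative is \<open>u / (1 + u)\<^sup>2\<close> with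
  \<open>u = \<rho> * exp y\<close>, and this never exceeds \<open>1 / 4\<close>.
\<close>

lemma ln_one_plus_exp_linearization:
  fixes \<rho> y :: real
  assumes "\<rho> > 0"
  shows "\<bar>ln (1 + \<rho> * exp y) - ln (1 + \<rho>) - \<rho> / (1 + \<rho>) * y\<bar> \<le> y\<^sup>2 / 8"
proof -
  define g where "g = (\<lambda>m::nat. \<lambda>t::real.
    if m = 0 then ln (1 + \<rho> * exp t)
    else if m = 1 then \<rho> * exp t / (1 + \<rho> * exp t)
    else \<rho> * exp t / (1 + \<rho> * exp t)\<^sup>2)"
  have pos: "1 + \<rho> * exp t > 0" for t
    using assms by (simp add: add_pos_pos)
  have d0: "DERIV (g 0) t :> g 1 t" for t
    unfolding g_def using pos[of t] by (auto intro!: derivative_eq_intros)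
  have d1: "DERIV (g 1) t :> g 2 t" for t
    unfolding g_def using pos[of t]
    by (auto intro!: derivative_eq_intros simp: power2_eq_square field_simps)
  have "DERIV (g m) t :> g (Suc m) t" if "m < 2" for m t
    using that d0 d1 by (cases m) (auto simp: numeral_2_eq_2 less_Suc_eq)
  then obtain t where t: "g 0 y = (\<Sum>m<2. g m 0 / fact m * y ^ m) + g 2 t / fact 2 * y\<^sup>2"
    using Maclaurin_bi_le[of g "g 0" 2 y] by blast
  have eq: "ln (1 + \<rho> * exp y) - ln (1 + \<rho>) - \<rho> / (1 + \<rho>) * y = g 2 t * y\<^sup>2 / 2"
    using t by (simp add: g_def numeral_2_eq_2)
  \<comment> \<open>AM-GM for \<open>1\<close> and \<open>u = \<rho> * exp t\<close>\<close>
  have "4 * (\<rho> * exp t) \<le> (1 + \<rho> * exp t)\<^sup>2"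
    using zero_le_power2[of "1 - \<rho> * exp t"] by (simp add: power2_eq_square algebra_simps)
  then have "g 2 t \<le> 1 / 4" "g 2 t \<ge> 0"
    using pos[of t] assms by (auto simp: g_def divide_le_eq)
  moreover from this have "g 2 t * y\<^sup>2 \<le> 1 / 4 * y\<^sup>2"
    by (intro mult_right_mono) auto
  ultimately show ?thesis
    unfolding eq by (simp add: abs_of_nonneg mult.commute)
qed

text \<open>
  A contribution \<open>b\<^sub>j\<close> is multiplied only by the later factors \<open>a\<^sub>i\<close>, and since these are
  all at least \<open>1\<close>, it cannot gain more than by being multiplied by the whole product.
\<close>

lemma linear_recursion_bounds:
  assumes a: "\<And>i. a i \<omega> \<ge> 1" and b: "\<And>i. b i \<omega> \<ge> 0"
  shows "(\<Prod>i<n. a i \<omega>) * x0 \<le> linear_recursion a b x0 n \<omega>"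
    and "linear_recursion a b x0 n \<omega> \<le> (\<Prod>i<n. a i \<omega>) * (x0 + (\<Sum>i<n. b i \<omega>))"
proof -
  show "(\<Prod>i<n. a i \<omega>) * x0 \<le> linear_recursion a b x0 n \<omega>"
  proof (induction n)
    case (Suc n)
    have "a n \<omega> * ((\<Prod>i<n. a i \<omega>) * x0) \<le> a n \<omega> * linear_recursion a b x0 n \<omega>"
      using Suc a[of n] by (intro mult_left_mono) auto
    then show ?case using b[of n] by (simp add: mult_ac)
  qed simp
  show "linear_recursion a b x0 n \<omega> \<le> (\<Prod>i<n. a i \<omega>) * (x0 + (\<Sum>i<n. b i \<omega>))"
  proof (induction n)
    case (Suc n)
    have "a n \<omega> * linear_recursion a b x0 n \<omega> \<le> a n \<omega> * ((\<Prod>i<n. a i \<omega>) * (x0 + (\<Sum>i<n. b i \<omega>)))"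
      using Suc a[of n] by (intro mult_left_mono) auto
    moreover have "1 * b n \<omega> \<le> (\<Prod>i<Suc n. a i \<omega>) * b n \<omega>"
      using a b[of n] by (intro mult_right_mono prod_ge_1) auto
    ultimately show ?case by (simp add: algebra_simps)
  qed simp
qed

text \<open>
  The logarithm of \<open>1 + (\<Sum>i<n. b\<^sub>i) / x\<^sub>0\<close> is bounded by an affine function of \<open>\<Sum>i<n. b\<^sub>i\<close>, so that
  the right-hand side can be integrated when nothing but the means of the \<open>b\<^sub>i\<close> is known. Taking
  the tangent at \<open>1 + n\<close>, the order of magnitude of the sum, makes the slope small enough
  to leave only a bounded expectation beside \<open>ln (1 + n)\<close>.
\<close>

lemma ln_linear_recursion_deviation:
  fixes \<rho> x0 :: real and y :: "nat \<Rightarrow> real"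
  assumes "\<rho> > 0" and "x0 > 0" and a: "\<And>i. a i \<omega> = 1 + \<rho> * exp (y i)"
    and b: "\<And>i. b i \<omega> \<ge> 0"
  shows "\<bar>ln (linear_recursion a b x0 n \<omega>) - real n * ln (1 + \<rho>) - \<rho> / (1 + \<rho>) * (\<Sum>i<n. y i)\<bar>
    \<le> (\<Sum>i<n. (y i)\<^sup>2 / 8) + \<bar>ln x0\<bar> + ln (1 + real n) + (\<Sum>i<n. b i \<omega>) / (x0 * (1 + real n))"
proof -
  define x where "x = linear_recursion a b x0 n \<omega>"
  define P where "P = (\<Prod>i<n. a i \<omega>)"
  define S where "S = (\<Sum>i<n. b i \<omega>)"
  have a1: "a i \<omega> \<ge> 1" for i using \<open>\<rho> > 0\<close> by (simp add: a)
  have a0: "a i \<omega> > 0" for i using a1[of i] by simp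
  have P: "P > 0" unfolding P_def by (intro prod_pos a0)
  have S: "S \<ge> 0" unfolding S_def by (intro sum_nonneg b)
  have lo: "P * x0 \<le> x" and hi: "x \<le> P * (x0 + S)"
    using linear_recursion_bounds[where a = a and b = b and \<omega> = \<omega> and n = n and ?x0.0 = x0, OF a1 b] by (auto simp: x_def P_def S_def)
  have x: "x > 0" using lo P \<open>x0 > 0\<close> by (meson less_le_trans mult_pos_pos)
  have lnP: "ln P = (\<Sum>i<n. ln (1 + \<rho> * exp (y i)))"
    unfolding P_def a[symmetric]
    by (intro ln_prod finite_lessThan) (metis a0 less_irrefl)
  have 1: "ln P + ln x0 \<le> ln x"
    using lo P x \<open>x0 > 0\<close> by (simp flip: ln_mult_pos)
  have "ln x \<le> ln (P * (x0 + S))"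
    using hi x P S \<open>x0 > 0\<close> by simp
  also have "\<dots> = ln P + ln (x0 * (1 + S / x0))"
    using P S \<open>x0 > 0\<close> by (subst ln_mult_pos) (auto simp: distrib_left)
  also have "ln (x0 * (1 + S / x0)) = ln x0 + ln (1 + S / x0)"
    using S \<open>x0 > 0\<close> by (intro ln_mult_pos) (auto simp: add_pos_nonneg)
  also have "ln (1 + S / x0) \<le> ln (1 + real n) + S / (x0 * (1 + real n))"
  proof -
    \<comment> \<open>the tangent to the concave function \<open>ln\<close> at \<open>1 + n\<close>\<close>
    have pos: "1 + S / x0 > 0" using S \<open>x0 > 0\<close> by (simp add: add_pos_nonneg)
    have "ln (1 + S / x0) - ln (1 + real n) = ln ((1 + S / x0) / (1 + real n))"
      using pos by (simp add: ln_div)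
    also have "\<dots> \<le> (1 + S / x0) / (1 + real n) - 1"
      using pos by (intro ln_le_minus_one) simp
    also have "\<dots> \<le> S / (x0 * (1 + real n))"
      by (simp add: add_divide_distrib divide_le_eq)
    finally show ?thesis by simp
  qed
  finally have 2: "ln x \<le> ln P + (ln x0 + (ln (1 + real n) + S / (x0 * (1 + real n))))" by simp
  have "ln P - real n * ln (1 + \<rho>) - \<rho> / (1 + \<rho>) * (\<Sum>i<n. y i)
      = (\<Sum>i<n. ln (1 + \<rho> * exp (y i)) - ln (1 + \<rho>) - \<rho> / (1 + \<rho>) * y i)"
    by (simp add: lnP sum_subtractf sum_distrib_left)
  also have "\<bar>\<dots>\<bar> \<le> (\<Sum>i<n. (y i)\<^sup>2 / 8)"
    by (intro order.trans[OF sum_abs] sum_mono ln_one_plus_exp_linearization \<open>\<rho> > 0\<close>)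
  finally have 3: "\<bar>ln P - real n * ln (1 + \<rho>) - \<rho> / (1 + \<rho>) * (\<Sum>i<n. y i)\<bar> \<le> (\<Sum>i<n. (y i)\<^sup>2 / 8)" .
  have "0 \<le> ln (1 + real n) + S / (x0 * (1 + real n))" 
    using S \<open>x0 > 0\<close> by (intro add_nonneg_nonneg) auto
  with 1 2 3 show ?thesis
    unfolding x_def[symmetric] S_def[symmetric] by linarith
qed

section \<open>Centred normal laws\<close>

lemma normal_law_eq_distr_std_normal:
  assumes "v > 0"
  shows "normal_law 0 v = distr std_normal_distribution borel (\<lambda>x. sqrt v * x)"
proof -
  interpret N: prob_space std_normal_distribution
    by (rule prob_space_normal_density) simp
  have "distributed std_normal_distribution lborel (\<lambda>x. x) std_normal_density"
    unfolding distributed_def by (auto intro!: measure_eqI simp: emeasure_distr)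
  then have "distributed std_normal_distribution lborel (\<lambda>x. sqrt v * x) (normal_density 0 (sqrt v))"
    using N.normal_standard_normal_convert[of "sqrt v" "\<lambda>x. sqrt v * x" 0] assms by simp
  then show ?thesis
    unfolding distributed_def normal_law_def by (simp cong: distr_cong)
qed

lemma real_distribution_normal_law: "v > 0 \<Longrightarrow> real_distribution (normal_law 0 v)"
  unfolding normal_law_def real_distribution_def real_distribution_axioms_def
  by (auto intro!: prob_space_normal_density)

lemma char_normal_law:
  assumes "v > 0"
  shows "char (normal_law 0 v) t = of_real (exp (- (v * t\<^sup>2 / 2)))"
proof -
  have "char (normal_law 0 v) t = char std_normal_distribution (t * sqrt v)"
    unfolding char_def normal_law_eq_distr_std_normal[OF assms]
    by (subst integral_distr) (auto simp: mult_ac)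
  then show ?thesis
    using assms by (simp add: char_std_normal_distribution power_mult_distrib mult_ac)
qed

lemma has_bochner_integral_square_normal_law:
  assumes "v > 0"
  shows "has_bochner_integral (normal_law 0 v) (\<lambda>x. x\<^sup>2) v"
proof -
  have "has_bochner_integral lborel (\<lambda>x. normal_density 0 (sqrt v) x * x\<^sup>2) v"
    using normal_moment_even[of "sqrt v" 0 1] assms by (simp add: fact_numeral)
  then show ?thesis
    unfolding normal_law_def
    by (intro has_bochner_integral_density) (auto simp: normal_density_nonneg)
qed

lemma (in prob_space) char_weighted_sum_indep_normal:
  assumes "finite I" and indep: "indep_vars (\<lambda>_. borel) X I"
    and normal: "\<And>k. k \<in> I \<Longrightarrow> distr M borel (X k) = normal_law 0 (v k)"
    and pos: "\<And>k. k \<in> I \<Longrightarrow> v k > 0"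
  shows "char (distr M borel (\<lambda>\<omega>. \<Sum>k\<in>I. u k * X k \<omega>)) t
    = of_real (exp (- ((\<Sum>k\<in>I. (u k)\<^sup>2 * v k) * t\<^sup>2 / 2)))"
proof -
  have rv: "X k \<in> borel_measurable M" if "k \<in> I" for k
    using indep that by (auto simp: indep_vars_def)
  have "indep_vars (\<lambda>_. borel) (\<lambda>k \<omega>. u k * X k \<omega>) I"
    by (rule indep_vars_compose2[OF indep]) simp
  then have "char (distr M borel (\<lambda>\<omega>. \<Sum>k\<in>I. u k * X k \<omega>)) t
      = (\<Prod>k\<in>I. char (distr M borel (\<lambda>\<omega>. u k * X k \<omega>)) t)"
    by (rule char_distr_sum)
  also have "\<dots> = (\<Prod>k\<in>I. of_real (exp (- ((u k)\<^sup>2 * v k * t\<^sup>2 / 2))))"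
  proof (intro prod.cong refl)
    fix k assume "k \<in> I"
    then have k: "k \<in> I" by simp
    have "char (distr M borel (\<lambda>\<omega>. u k * X k \<omega>)) t = char (distr M borel (X k)) (t * u k)"
      unfolding char_def using rv[OF k] by (simp add: integral_distr mult_ac)
    also have "\<dots> = of_real (exp (- ((u k)\<^sup>2 * v k * t\<^sup>2 / 2)))"
      unfolding normal[OF k] char_normal_law[OF pos[OF k]] by (simp add: power_mult_distrib mult_ac)
    finally show "char (distr M borel (\<lambda>\<omega>. u k * X k \<omega>)) t
      = of_real (exp (- ((u k)\<^sup>2 * v k * t\<^sup>2 / 2)))" .
  qed
  also have "\<dots> = of_real (\<Prod>k\<in>I. exp (- ((u k)\<^sup>2 * v k * t\<^sup>2 / 2)))"
    by simp
  also have "(\<Prod>k\<in>I. exp (- ((u k)\<^sup>2 * v k * t\<^sup>2 / 2))) = exp (\<Sum>k\<in>I. - ((u k)\<^sup>2 * v k * t\<^sup>2 / 2))"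
    by (rule exp_sum[OF \<open>finite I\<close>, symmetric])
  also have "(\<Sum>k\<in>I. - ((u k)\<^sup>2 * v k * t\<^sup>2 / 2)) = - ((\<Sum>k\<in>I. (u k)\<^sup>2 * v k) * t\<^sup>2 / 2)"
    by (simp add: sum_negf sum_distrib_right sum_divide_distrib)
  finally show ?thesis .
qed

section \<open>Weak convergence under perturbations small in mean\<close>

text \<open>
  The function \<open>x \<mapsto> exp (\<i> * t * x)\<close> is Lipschitz with constant \<open>\<bar>t\<bar>\<close>.
\<close>

lemma (in prob_space) char_distr_perturbation:
  assumes [measurable]: "X \<in> borel_measurable M" "Y \<in> borel_measurable M"
    and D: "integrable M D" and le: "AE \<omega> in M. \<bar>Y \<omega> - X \<omega>\<bar> \<le> D \<omega>"
  shows "cmod (char (distr M borel Y) t - char (distr M borel X) t) \<le> \<bar>t\<bar> * expectation D"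
proof -
  have int: "integrable M (\<lambda>\<omega>. iexp (t * Z \<omega>))" if [measurable]: "Z \<in> borel_measurable M" for Z
    by (intro integrable_const_bound[of _ 1]) auto
  have "char (distr M borel Y) t - char (distr M borel X) t
      = (CLINT \<omega>|M. iexp (t * Y \<omega>) - iexp (t * X \<omega>))"
    by (simp add: char_def integral_distr int Bochner_Integration.integral_diff del: of_real_mult)
  also have "cmod \<dots> \<le> (\<integral>\<omega>. cmod (iexp (t * Y \<omega>) - iexp (t * X \<omega>)) \<partial>M)"
    by (rule integral_norm_bound)
  also have "\<dots> \<le> (\<integral>\<omega>. \<bar>t\<bar> * D \<omega> \<partial>M)"
  proof (intro integral_mono_AE)
    show "integrable M (\<lambda>\<omega>. cmod (iexp (t * Y \<omega>) - iexp (t * X \<omega>)))"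
      by (intro integrable_norm Bochner_Integration.integrable_diff int) auto
    show "AE \<omega> in M. cmod (iexp (t * Y \<omega>) - iexp (t * X \<omega>)) \<le> \<bar>t\<bar> * D \<omega>"
      using le
    proof eventually_elim
      case (elim \<omega>)
      have "iexp (t * Y \<omega>) - iexp (t * X \<omega>) = iexp (t * X \<omega>) * (iexp (t * (Y \<omega> - X \<omega>)) - 1)"
        by (simp add: algebra_simps flip: exp_add)
      then have "cmod (iexp (t * Y \<omega>) - iexp (t * X \<omega>)) = cmod (iexp (t * (Y \<omega> - X \<omega>)) - 1)"
        by (simp add: norm_mult del: of_real_mult of_real_diff)
      also have "\<dots> \<le> \<bar>t * (Y \<omega> - X \<omega>)\<bar>"
        using iexp_approx1[of "t * (Y \<omega> - X \<omega>)" 0] by simp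
      also have "\<dots> \<le> \<bar>t\<bar> * D \<omega>"
        unfolding abs_mult using elim by (intro mult_left_mono) auto
      finally show ?case .
    qed
  qed (use D in simp)
  finally show ?thesis using D by simp
qed

text \<open>
  A form of Slutsky's theorem. The dominating variables \<open>D n\<close> spare a separate
  proof that the differences are integrable.
\<close>

lemma (in prob_space) weak_conv_L1_perturbation:
  fixes X Y D :: "nat \<Rightarrow> 'a \<Rightarrow> real"
  assumes X: "\<And>n. X n \<in> borel_measurable M" and Y: "\<And>n. Y n \<in> borel_measurable M"
    and \<mu>: "real_distribution \<mu>"
    and lim: "\<And>t. (\<lambda>n. char (distr M borel (X n)) t) \<longlonglongrightarrow> char \<mu> t"
    and D: "\<forall>\<^sub>F n in sequentially. integrable M (D n) \<and> (AE \<omega> in M. \<bar>Y n \<omega> - X n \<omega>\<bar> \<le> D n \<omega>)"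
    and D0: "(\<lambda>n. expectation (D n)) \<longlonglongrightarrow> 0"
  shows "weak_conv_m (\<lambda>n. distr M borel (Y n)) \<mu>"
proof (rule levy_continuity[OF _ \<mu>])
  show "real_distribution (distr M borel (Y n))" for n
    using Y by (simp add: real_distribution_distr)
  fix t
  have "(\<lambda>n. char (distr M borel (Y n)) t - char (distr M borel (X n)) t) \<longlonglongrightarrow> 0"
  proof (rule Lim_null_comparison)
    show "\<forall>\<^sub>F n in sequentially. cmod (char (distr M borel (Y n)) t - char (distr M borel (X n)) t)
        \<le> \<bar>t\<bar> * expectation (D n)"
      using D by eventually_elim (intro char_distr_perturbation X Y; simp)
    show "(\<lambda>n. \<bar>t\<bar> * expectation (D n)) \<longlonglongrightarrow> 0"
      using tendsto_mult_right_zero[OF D0] by blast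
  qed
  from tendsto_add[OF this lim[of t]]
  show "(\<lambda>n. char (distr M borel (Y n)) t) \<longlonglongrightarrow> char \<mu> t" by simp
qed

section \<open>Brownian motion on an equidistant grid\<close>

lemma (in standard_brownian_motion) has_bochner_integral_square:
  assumes "0 \<le> t"
  shows "has_bochner_integral M (\<lambda>\<omega>. (W t \<omega>)\<^sup>2) t"
proof -
  have [measurable]: "W t \<in> borel_measurable M" "W 0 \<in> borel_measurable M"
    using W_measurable assms by auto
  have eq: "AE \<omega> in M. (W t \<omega> - W 0 \<omega>)\<^sup>2 = (W t \<omega>)\<^sup>2"
    using W_start by eventually_elim simp
  show ?thesis
  proof (cases "t = 0")
    case True
    have "has_bochner_integral M (\<lambda>\<omega>. 0::real) 0" by (rule has_bochner_integral_zero)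
    moreover have "AE \<omega> in M. 0 = (W t \<omega>)\<^sup>2" using W_start True by auto
    ultimately show ?thesis
      using True by (subst has_bochner_integral_cong_AE[symmetric, where f = "\<lambda>_. 0"]) auto
  next
    case False
    then have "has_bochner_integral (distr M borel (\<lambda>\<omega>. W t \<omega> - W 0 \<omega>)) (\<lambda>x. x\<^sup>2) t"
      using W_normal_increments[of 0 t] has_bochner_integral_square_normal_law[of t] assms by simp
    then have "has_bochner_integral M (\<lambda>\<omega>. (W t \<omega> - W 0 \<omega>)\<^sup>2) t"
      by (simp add: has_bochner_integral_iff integrable_distr_eq integral_distr)
    then show ?thesis
      using has_bochner_integral_cong_AE[OF _ _ eq] by auto
  qed
qed

text \<open>
  Summation by parts: the increment over step \<open>k\<close> is contained in the later values
  \<open>w (Suc k), \<dots>, w (n - 1)\<close>, that is \<open>n - Suc k\<close> times.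
\<close>

lemma sum_path_eq_weighted_sum_increments:
  fixes w :: "nat \<Rightarrow> real"
  shows "(\<Sum>i<n. w i) = real n * w 0 + (\<Sum>k<n. real (n - Suc k) * (w (Suc k) - w k))"
proof (induction n)
  case (Suc n)
  have "(\<Sum>k<Suc n. real (Suc n - Suc k) * (w (Suc k) - w k))
      = (\<Sum>k<n. real (n - Suc k) * (w (Suc k) - w k) + (w (Suc k) - w k))"
    by (simp add: Suc_diff_Suc algebra_simps)
  also have "\<dots> = (\<Sum>k<n. real (n - Suc k) * (w (Suc k) - w k)) + (w n - w 0)"
    by (simp add: sum.distrib sum_lessThan_telescope)
  finally show ?case using Suc by (simp add: algebra_simps)
qed simp

text \<open>
  The values on the grid are correlated, but their sum is a weighted sum of the independent
  increments, with the weights \<open>n - 1, \<dots>, 1, 0\<close>; the sum is thus centred normal with variance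
  \<open>\<tau> * (\<Sum>k<n. k\<^sup>2)\<close>. The law is given by its characteristic function, which
  also covers \<open>c = 0\<close> and \<open>n \<le> 1\<close>, where it is a point mass.
\<close>

lemma (in standard_brownian_motion) char_grid_sum:
  assumes "\<tau> > 0"
  shows "char (distr M borel (\<lambda>\<omega>. c * (\<Sum>i<n. W (real i * \<tau>) \<omega>))) t
    = of_real (exp (- (c\<^sup>2 * \<tau> * (\<Sum>k<n. (real k)\<^sup>2) * t\<^sup>2 / 2)))"
proof -
  define \<Delta> where "\<Delta> k \<omega> = W (real (Suc k) * \<tau>) \<omega> - W (real k * \<tau>) \<omega>" for k \<omega>
  define S where "S \<omega> = (\<Sum>k<n. c * real (n - Suc k) * \<Delta> k \<omega>)" for \<omega>
  have W_rv [measurable]: "W (real i * \<tau>) \<in> borel_measurable M" for i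
    using W_measurable assms by simp
  have [measurable]: "\<Delta> k \<in> borel_measurable M" for k
    unfolding \<Delta>_def using W_rv[of "Suc k"] W_rv[of k] by (intro borel_measurable_diff)
  have [measurable]: "S \<in> borel_measurable M" unfolding S_def by measurable
  have "AE \<omega> in M. c * (\<Sum>i<n. W (real i * \<tau>) \<omega>) = S \<omega>"
    using W_start
  proof eventually_elim
    case (elim \<omega>)
    then show ?case
      by (subst sum_path_eq_weighted_sum_increments) (simp add: S_def \<Delta>_def sum_distrib_left mult_ac)
  qed
  then have "char (distr M borel (\<lambda>\<omega>. c * (\<Sum>i<n. W (real i * \<tau>) \<omega>))) t = char (distr M borel S) t"
    by (intro arg_cong[where f = "\<lambda>\<mu>. char \<mu> t"] distr_cong_AE) auto
  also have "\<dots> = of_real (exp (- ((\<Sum>k<n. (c * real (n - Suc k))\<^sup>2 * \<tau>) * t\<^sup>2 / 2)))"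
    unfolding S_def
  proof (rule char_weighted_sum_indep_normal)
    show "indep_vars (\<lambda>_. borel) \<Delta> {..<n}"
      using W_indep_increments[of "\<lambda>i. real i * \<tau>" n] assms by (simp add: \<Delta>_def[abs_def])
    show "distr M borel (\<Delta> k) = normal_law 0 \<tau>" for k
      using W_normal_increments[of "real k * \<tau>" "real (Suc k) * \<tau>"] assms
      by (simp add: \<Delta>_def[abs_def] algebra_simps)
  qed (use assms in auto)
  also have "(\<Sum>k<n. (c * real (n - Suc k))\<^sup>2 * \<tau>) = (\<Sum>k<n. (c * real k)\<^sup>2 * \<tau>)"
    by (rule sum.nat_diff_reindex)
  also have "\<dots> = c\<^sup>2 * \<tau> * (\<Sum>k<n. (real k)\<^sup>2)"
    by (simp add: sum_distrib_left power_mult_distrib mult_ac)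
  finally show ?thesis .
qed

section \<open>The central limit theorem for the logarithm\<close>

lemma sum_squares_lessThan_over_cube: "(\<lambda>n. (\<Sum>k<n. (real k)\<^sup>2) / real n ^ 3) \<longlonglongrightarrow> 1 / 3"
proof -
  have eq: "(\<Sum>k<n. (real k)\<^sup>2) = (real n - 1) * real n * (2 * real n - 1) / 6" for n
    by (induction n) (auto simp: field_simps power2_eq_square)
  show ?thesis unfolding eq by real_asymp
qed

theorem proposition8:
  fixes M :: "'a measure"
    and W :: "real \<Rightarrow> 'a \<Rightarrow> real"
    and b :: "nat \<Rightarrow> 'a \<Rightarrow> real"
    and \<rho> \<beta> x0 :: real
    and \<sigma> \<tau> :: "nat \<Rightarrow> real"
  assumes "\<rho> > 0" and "\<beta> > 0" and "x0 > 0"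
    and "\<And>n. n \<ge> 1 \<Longrightarrow> \<sigma> n > 0"
    and "\<And>n. n \<ge> 1 \<Longrightarrow> \<tau> n > 0"
    and "\<And>n. n \<ge> 1 \<Longrightarrow> 1 / 2 * (\<sigma> n)\<^sup>2 * \<tau> n * (real n)\<^sup>2 = \<beta>"
    and "standard_brownian_motion M W"
    and "prob_space.indep_vars M (\<lambda>_. borel) b UNIV"
    and "\<And>i. distr M borel (b i) = distr M borel (b 0)"
    and "\<And>i. AE \<omega> in M. b i \<omega> \<ge> 0"
    and "\<And>i. integrable M (b i)"
    and "\<And>n. n \<ge> 1 \<Longrightarrow>
           prob_space.indep_var M
             (PiM UNIV (\<lambda>_::nat. borel)) (\<lambda>\<omega> i. multiplier \<rho> (\<sigma> n) (\<tau> n) W i \<omega>)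
             (PiM UNIV (\<lambda>_::nat. borel)) (\<lambda>\<omega> i. b i \<omega>)"
  shows "weak_conv_m
           (\<lambda>n. distr M borel
              (\<lambda>\<omega>. (ln (linear_recursion (multiplier \<rho> (\<sigma> n) (\<tau> n) W) b x0 n \<omega>)
                     - real n * ln (1 + \<rho>)) / sqrt (real n)))
           (normal_law 0 (2 * \<beta> / 3 * (\<rho>\<^sup>2 / (1 + \<rho>)\<^sup>2)))"
proof -
  interpret standard_brownian_motion M W by fact
  define c where "c = \<rho> / (1 + \<rho>)"
  have c: "0 < c" "c \<le> 1" using \<open>\<rho> > 0\<close> by (auto simp: c_def)
  \<comment> \<open>\<open>X n\<close> is the Gaussian main term, \<open>Y n\<close> the variable of the theorem, \<open>D n\<close> an integrable bound for
    their distance. In \<open>K\<close>, the part \<open>\<beta>\<^sup>2 / 4\<close> comes from the squares of the drifts and \<open>\<beta>\<close>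
    from their sum.\<close>
  define X where "X n \<omega> = c * \<sigma> n / sqrt (real n) * (\<Sum>i<n. W (real i * \<tau> n) \<omega>)" for n \<omega>
  define L where "L n \<omega> = ln (linear_recursion (multiplier \<rho> (\<sigma> n) (\<tau> n) W) b x0 n \<omega>)" for n \<omega>
  define Y where "Y n \<omega> = (L n \<omega> - real n * ln (1 + \<rho>)) / sqrt (real n)" for n \<omega>
  define K where "K = \<beta>\<^sup>2 / 4 + \<beta> + \<bar>ln x0\<bar>"
  define D where "D n \<omega> = ((\<Sum>i<n. (\<sigma> n * W (real i * \<tau> n) \<omega>)\<^sup>2 / 4) + K
      + ln (1 + real n) + (\<Sum>i<n. b i \<omega>) / (x0 * (1 + real n))) / sqrt (real n)" for n \<omega>
  \<comment> \<open>the variance of a single increment of \<open>\<sigma> W\<close>\<close>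
  have step: "(\<sigma> n)\<^sup>2 * \<tau> n = 2 * \<beta> / (real n)\<^sup>2" if "n \<ge> 1" for n
    using assms(6)[OF that] that by (simp add: field_simps)
  have W_rv: "W (real i * \<tau> n) \<in> borel_measurable M" if "n \<ge> 1" for i n
    using W_measurable assms(5)[OF that] by simp
  have b_rv [measurable]: "b i \<in> borel_measurable M" for i using assms(11) by auto
  have x_rv: "(\<lambda>\<omega>. linear_recursion (multiplier \<rho> (\<sigma> n) (\<tau> n) W) b x0 k \<omega>) \<in> borel_measurable M"
    if "n \<ge> 1" for n k
  proof (induction k)
    case (Suc k)
    have "multiplier \<rho> (\<sigma> n) (\<tau> n) W k \<in> borel_measurable M"
      using W_rv[OF that] unfolding multiplier_def[abs_def] by measurable
    with Suc show ?case by simp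
  qed simp
  \<comment> \<open>For \<open>n = 0\<close> the parameters \<open>\<sigma>\<close> and \<open>\<tau>\<close> are arbitrary, but then \<open>X\<close> and \<open>Y\<close> are constants.\<close>
  have X_rv: "X n \<in> borel_measurable M" for n
  proof (cases "n \<ge> 1")
    case True
    note [measurable] = W_rv[OF True]
    show ?thesis unfolding X_def by measurable
  next
    case False
    then have "n = 0" by simp
    then show ?thesis by (simp add: X_def[abs_def])
  qed
  have Y_rv: "Y n \<in> borel_measurable M" for n
  proof (cases "n \<ge> 1")
    case True
    note [measurable] = x_rv[OF True]
    show ?thesis unfolding Y_def L_def by measurable
  next
    case False
    then have "n = 0" by simp
    then show ?thesis by (simp add: Y_def[abs_def] L_def)
  qed

  have v: "2 * \<beta> / 3 * (\<rho>\<^sup>2 / (1 + \<rho>)\<^sup>2) = c\<^sup>2 * 2 * \<beta> * (1 / 3)"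
    by (simp add: c_def power_divide mult_ac)
  have "weak_conv_m (\<lambda>n. distr M borel (Y n)) (normal_law 0 (c\<^sup>2 * 2 * \<beta> * (1 / 3)))"
  proof (rule weak_conv_L1_perturbation[where X = X and D = D])
    show "real_distribution (normal_law 0 (c\<^sup>2 * 2 * \<beta> * (1 / 3)))"
      using c \<open>\<beta> > 0\<close> by (intro real_distribution_normal_law) simp
  next
    fix t
    have "(\<lambda>n. complex_of_real (exp (- (c\<^sup>2 * 2 * \<beta> * ((\<Sum>k<n. (real k)\<^sup>2) / real n ^ 3) * t\<^sup>2 / 2))))
        \<longlonglongrightarrow> of_real (exp (- (c\<^sup>2 * 2 * \<beta> * (1 / 3) * t\<^sup>2 / 2)))"
      by (intro tendsto_intros sum_squares_lessThan_over_cube) simp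
    also have "of_real (exp (- (c\<^sup>2 * 2 * \<beta> * (1 / 3) * t\<^sup>2 / 2))) = char (normal_law 0 (c\<^sup>2 * 2 * \<beta> * (1 / 3))) t"
      using c \<open>\<beta> > 0\<close> by (subst char_normal_law) auto
    finally show "(\<lambda>n. char (distr M borel (X n)) t) \<longlonglongrightarrow> char (normal_law 0 (c\<^sup>2 * 2 * \<beta> * (1 / 3))) t"
    proof (rule Lim_transform_eventually)
      show "\<forall>\<^sub>F n in sequentially. complex_of_real
          (exp (- (c\<^sup>2 * 2 * \<beta> * ((\<Sum>k<n. (real k)\<^sup>2) / real n ^ 3) * t\<^sup>2 / 2))) = char (distr M borel (X n)) t"
        using eventually_ge_at_top[of 1]
      proof eventually_elim
        case (elim n)
        have "(c * \<sigma> n / sqrt (real n))\<^sup>2 * \<tau> n = c\<^sup>2 * ((\<sigma> n)\<^sup>2 * \<tau> n) / real n"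
          using elim by (simp add: power_mult_distrib power_divide)
        also have "\<dots> = c\<^sup>2 * 2 * \<beta> / real n ^ 3"
          unfolding step[OF elim] by (simp add: power2_eq_square power3_eq_cube)
        finally show ?case
          unfolding X_def char_grid_sum[OF assms(5)[OF elim]] by simp
      qed
    qed
  next
    show "\<forall>\<^sub>F n in sequentially. integrable M (D n) \<and> (AE \<omega> in M. \<bar>Y n \<omega> - X n \<omega>\<bar> \<le> D n \<omega>)"
      using eventually_ge_at_top[of 1]
    proof eventually_elim
      case (elim n)
      have "integrable M (\<lambda>\<omega>. (W (real i * \<tau> n) \<omega>)\<^sup>2)" for i
        using has_bochner_integral_square[of "real i * \<tau> n"] assms(5)[OF elim]
        by (simp add: has_bochner_integral_iff)
      then have "integrable M (D n)"
        unfolding D_def power_mult_distrib using assms(11) by (intro Bochner_Integration.integrable_add integrable_divide Bochner_Integration.integrable_sum) auto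
      moreover have "AE \<omega> in M. \<forall>i. b i \<omega> \<ge> 0"
        using assms(10) by (simp add: AE_all_countable)
      then have "AE \<omega> in M. \<bar>Y n \<omega> - X n \<omega>\<bar> \<le> D n \<omega>"
      proof eventually_elim
        case (elim \<omega>)
        \<comment> \<open>the exponent of the \<open>i\<close>-th multiplier is \<open>z i - m i\<close>, noise minus drift\<close>
        define m where "m i = \<beta> * real i / (real n)\<^sup>2" for i
        define z where "z i = \<sigma> n * W (real i * \<tau> n) \<omega>" for i
        have m: "0 \<le> m i" "m i \<le> \<beta> / real n" if "i < n" for i
          using that \<open>\<beta> > 0\<close> by (auto simp: m_def field_simps power2_eq_square)
        have mult: "multiplier \<rho> (\<sigma> n) (\<tau> n) W i \<omega> = 1 + \<rho> * exp (z i - m i)" for i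
          using assms(6)[OF \<open>1 \<le> n\<close>, symmetric] \<open>1 \<le> n\<close> by (simp add: multiplier_def z_def m_def field_simps)
        have "\<bar>L n \<omega> - real n * ln (1 + \<rho>) - c * (\<Sum>i<n. z i - m i)\<bar>
            \<le> (\<Sum>i<n. (z i - m i)\<^sup>2 / 8) + \<bar>ln x0\<bar> + ln (1 + real n) + (\<Sum>i<n. b i \<omega>) / (x0 * (1 + real n))"
          unfolding L_def c_def
          by (rule ln_linear_recursion_deviation[OF \<open>\<rho> > 0\<close> \<open>x0 > 0\<close>]) (use mult elim in auto)
        moreover have "(\<Sum>i<n. (z i - m i)\<^sup>2 / 8) \<le> (\<Sum>i<n. (z i)\<^sup>2 / 4) + \<beta>\<^sup>2 / 4"
        proof -
          have "(\<Sum>i<n. (z i - m i)\<^sup>2 / 8) \<le> (\<Sum>i<n. (z i)\<^sup>2 / 4 + (\<beta> / real n)\<^sup>2 / 4)"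
          proof (rule sum_mono)
            fix i assume "i \<in> {..<n}"
            then have "(m i)\<^sup>2 \<le> (\<beta> / real n)\<^sup>2" using m by (intro power_mono) auto
            moreover have "(z i - m i)\<^sup>2 \<le> 2 * (z i)\<^sup>2 + 2 * (m i)\<^sup>2"
              using zero_le_power2[of "z i + m i"] by (simp add: power2_eq_square algebra_simps)
            ultimately show "(z i - m i)\<^sup>2 / 8 \<le> (z i)\<^sup>2 / 4 + (\<beta> / real n)\<^sup>2 / 4" by simp
          qed
          also have "\<dots> = (\<Sum>i<n. (z i)\<^sup>2 / 4) + \<beta>\<^sup>2 / 4 / real n"
            using \<open>1 \<le> n\<close> by (simp add: sum.distrib power_divide power2_eq_square)
          also have "\<beta>\<^sup>2 / 4 / real n \<le> \<beta>\<^sup>2 / 4"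
            using \<open>1 \<le> n\<close> by (simp add: divide_le_eq mult_le_cancel_left1)
          finally show ?thesis by simp
        qed
        moreover have "\<bar>c * (\<Sum>i<n. m i)\<bar> \<le> \<beta>"
        proof -
          have "(\<Sum>i<n. m i) \<le> (\<Sum>i<n. \<beta> / real n)" using m by (intro sum_mono) auto
          then have "(\<Sum>i<n. m i) \<le> \<beta>" using \<open>1 \<le> n\<close> by simp
          moreover have "0 \<le> (\<Sum>i<n. m i)" using m by (intro sum_nonneg) auto
          ultimately show ?thesis using c mult_mono[of c 1 "\<Sum>i<n. m i" \<beta>] by simp
        qed
        moreover have "c * (\<Sum>i<n. z i - m i) = c * (\<Sum>i<n. z i) - c * (\<Sum>i<n. m i)"
          by (simp add: sum_subtractf right_diff_distrib)
        ultimately have "\<bar>L n \<omega> - real n * ln (1 + \<rho>) - c * (\<Sum>i<n. z i)\<bar>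
            \<le> (\<Sum>i<n. (z i)\<^sup>2 / 4) + K + ln (1 + real n) + (\<Sum>i<n. b i \<omega>) / (x0 * (1 + real n))"
          unfolding K_def by linarith
        then have "\<bar>L n \<omega> - real n * ln (1 + \<rho>) - c * (\<Sum>i<n. z i)\<bar> / sqrt (real n) \<le> D n \<omega>"
          unfolding D_def z_def by (intro divide_right_mono) auto
        moreover have "Y n \<omega> - X n \<omega> = (L n \<omega> - real n * ln (1 + \<rho>) - c * (\<Sum>i<n. z i)) / sqrt (real n)"
          by (simp add: Y_def X_def z_def sum_distrib_left[symmetric] diff_divide_distrib)
        ultimately show ?case by (simp add: abs_divide)
      qed
      ultimately show ?case by blast
    qed
  next
    define B where "B = expectation (b 0)"
    have exp_b: "expectation (b i) = B" for i
    proof -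
      have "expectation (b i) = (\<integral>x. x \<partial>distr M borel (b i))" by (simp add: integral_distr)
      also have "\<dots> = B" by (subst assms(9)) (simp add: integral_distr B_def)
      finally show ?thesis .
    qed
    have "\<forall>\<^sub>F n in sequentially. norm (expectation (D n))
        \<le> (\<beta> / 2 + K + ln (1 + real n) + B / x0) / sqrt (real n)"
      using eventually_ge_at_top[of 1]
    proof eventually_elim
      case (elim n)
      have sq: "integrable M (\<lambda>\<omega>. (W (real i * \<tau> n) \<omega>)\<^sup>2)"
          "expectation (\<lambda>\<omega>. (W (real i * \<tau> n) \<omega>)\<^sup>2) = real i * \<tau> n" for i
        using has_bochner_integral_square[of "real i * \<tau> n"] assms(5)[OF elim]
        by (simp_all add: has_bochner_integral_iff)
      have b0: "B \<ge> 0" unfolding B_def by (intro integral_nonneg_AE assms(10))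
      have K: "K \<ge> 0" using \<open>\<beta> > 0\<close> by (simp add: K_def)
      have E: "expectation (D n) = ((\<Sum>i<n. (\<sigma> n)\<^sup>2 * (real i * \<tau> n) / 4) + K
          + ln (1 + real n) + real n * B / (x0 * (1 + real n))) / sqrt (real n)"
        unfolding D_def power_mult_distrib using assms(11) sq by (simp add: exp_b prob_space)
      have "(\<Sum>i<n. (\<sigma> n)\<^sup>2 * (real i * \<tau> n) / 4) \<le> (\<Sum>i<n. \<beta> / 2 / real n)"
      proof (rule sum_mono)
        fix i assume "i \<in> {..<n}"
        then have "real i * (2 * \<beta> / (real n)\<^sup>2) \<le> real n * (2 * \<beta> / (real n)\<^sup>2)"
          using \<open>\<beta> > 0\<close> by (intro mult_right_mono) auto
        then have "(\<sigma> n)\<^sup>2 * \<tau> n * real i \<le> 2 * \<beta> / real n"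
          using elim unfolding step[OF elim] by (simp add: power2_eq_square mult_ac)
        then show "(\<sigma> n)\<^sup>2 * (real i * \<tau> n) / 4 \<le> \<beta> / 2 / real n"
          by (simp add: mult_ac)
      qed
      also have "\<dots> = \<beta> / 2" using elim by simp
      finally have 1: "(\<Sum>i<n. (\<sigma> n)\<^sup>2 * (real i * \<tau> n) / 4) \<le> \<beta> / 2" .
      have 2: "real n * B / (x0 * (1 + real n)) \<le> B / x0"
        using b0 \<open>x0 > 0\<close> by (simp add: divide_simps) (simp add: algebra_simps)
      have 3: "expectation (D n) \<ge> 0"
        unfolding E using K b0 \<open>x0 > 0\<close> less_imp_le[OF assms(5)[OF elim]] 
        by (intro divide_nonneg_nonneg add_nonneg_nonneg sum_nonneg) auto
      have "expectation (D n) \<le> (\<beta> / 2 + K + ln (1 + real n) + B / x0) / sqrt (real n)"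
        unfolding E using 1 2 by (intro divide_right_mono add_mono) auto
      with 3 show ?case by simp
    qed
    moreover have "(\<lambda>n. (\<beta> / 2 + K + ln (1 + real n) + B / x0) / sqrt (real n)) \<longlonglongrightarrow> 0"
      by real_asymp
    ultimately show "(\<lambda>n. expectation (D n)) \<longlonglongrightarrow> 0"
      by (rule Lim_null_comparison)
  qed (fact X_rv Y_rv)+
  then show ?thesis
    unfolding v Y_def[abs_def] L_def .
qed

end
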